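(* Let $N\ge2$ and let $(\theta_t)_{t\ge0}$ be the ACCA dynamics on the ring, with first singular time $\tau$, winding number $W_0$ of $\theta_0$, and $\beta=\frac{2\pi W_0}N$. Let $(\eta_t)$ be its lifted representation (from some initial lift $\eta_0$ of $\theta_0$), $(s_t)$ the compensator and $(\zeta_t)$ the detrended process. Then, on the event $\{\tau=\infty\}$, there exists a (random) constant $\alpha^\star\in\mathbb R$ such that \[ \lim_{t\to\infty}\max_{1\le i\le N}\big|\zeta_t(i)-\alpha^\star\big|=0\qquad\text{almost surely} \] (i.e. the set of trajectories with $\tau=\infty$ for which no such $\alpha^\star$ exists has probability zero).
   Context: For $a\in\mathbb R$, $\operatorname{wrap}_\pi(a):=a-2\pi\lfloor\frac{a+\pi}{2\pi}\rfloor\in[-\pi,\pi)$. The ring has vertices $1,\dots,N$ and edges $(i,i+1)$, $1\le i\le N$; vertex indices of $\theta$, $\delta$, $S_\pm$ are read modulo $N$. For a configuration $\theta_t\in[-\pi,\pi)^N$: $\delta_t(i):=\operatorname{wrap}_\pi(\theta_t(i+1)-\theta_t(i))$, $1\le i\le N$; $W_t:=\frac1{2\pi}\sum_{i=1}^N\delta_t(i)\in\mathbb Z$; $S^{(t)}_\pm(k):=\delta_t(k\pm1)+\frac12\delta_t(k)$. ACCA dynamics: start from an initial configuration $\theta_0\in[-\pi,\pi)^N$; at each step $t$ an edge $(k_t,k_t+1)$ is chosen uniformly at random among the $N$ edges, independently of the past; with $k=k_t$, $\theta_{t+1}(k)=\operatorname{wrap}_\pi(\theta_t(k)+\frac12\delta_t(k))$,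 $\theta_{t+1}(k+1)=\operatorname{wrap}_\pi(\theta_t(k+1)-\frac12\delta_t(k))$ (these coincide), and all other values are unchanged. (If $\delta_t(k)=-\pi$, the common new value is chosen with probability $1/2$ each between $\operatorname{wrap}_\pi(\theta_t(k)\pm\frac\pi2)$.) First singular time: $\tau:=\inf\{t\ge0:\ \exists k,\ S^{(t)}_-(k)\notin(-\pi,\pi)\text{ or }S^{(t)}_+(k)\notin(-\pi,\pi)\text{ or }\delta_t(k)=-\pi\}\in\mathbb N_0\cup\{\infty\}$. On $\{\tau=\infty\}$ one has $W_t=W_0$ for all $t$. Lift: a lift of $\theta\in[-\pi,\pi)^N$ is a vector $\eta\in\mathbb R^{N+1}$ with $\eta(i+1)-\eta(i)=\delta(i)$ for $1\le i\le N$ and $\operatorname{wrap}_\pi(\eta(1))=\theta(1)$. Lifted representation: given an initial lift $\eta_0$ of $\theta_0$, for $t<\tau$ define $\eta_{t+1}\in\mathbb R^{N+1}$ by $\eta_{t+1}(k_t)=\eta_{t+1}(k_t+1):=\frac{\eta_t(k_t)+\eta_t(k_t+1)}2$ (for $k_t=N$ the index $k_t+1$ is $N+1$, not $1$) and by the increment relations $\eta_{t+1}(i+1)-\eta_{t+1}(i)=\delta_{t+1}(i)$, $1\le i\le N$. Compensator: $s_0\equiv0\in\mathbb R^N$; when edge $(k,k+1)$ is updated at time $t$ (with $k+1$ read as $1$ if $k=N$), $s_{t+1}(k)=\frac{s_t(k)+s_t(k+1)}2+\frac\beta2$, $s_{t+1}(k+1)=\frac{s_t(k)+s_t(k+1)}2-\frac\beta2$,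 and $s_{t+1}(i)=s_t(i)$ otherwise; set $s_t(N+1):=s_t(1)$. Detrended process: $\zeta_t(i):=\eta_t(i)-\beta(i-1)-s_t(i)$, $1\le i\le N+1$. *)

theory Defs
  imports "HOL-Probability.Probability"
begin

text \<open>
  Vectors indexed by \<open>1, \<dots>, n\<close> are functions \<open>nat \<Rightarrow> real\<close> of which only the values at
  \<open>1, \<dots>, n\<close> matter (\<open>n = N\<close> for ring configurations and compensators, \<open>n = N + 1\<close> for lifts).
\<close>

definition wrap :: "real \<Rightarrow> real" where
  "wrap a = a - 2 * pi * of_int \<lfloor>(a + pi) / (2 * pi)\<rfloor>"

text \<open>The representative in \<open>{1..N}\<close> of the residue class of \<open>i\<close> modulo \<open>N\<close>;
  in particular \<open>vtx N 0 = N\<close> and \<open>vtx N (N + 1) = 1\<close>.\<close>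

definition vtx :: "nat \<Rightarrow> nat \<Rightarrow> nat" where
  "vtx N i = (if i mod N = 0 then N else i mod N)"

definition configuration :: "nat \<Rightarrow> (nat \<Rightarrow> real) \<Rightarrow> bool" where
  "configuration N \<theta> \<longleftrightarrow> (\<forall>i\<in>{1..N}. \<theta> i \<in> {-pi..<pi})"

definition delta :: "nat \<Rightarrow> (nat \<Rightarrow> real) \<Rightarrow> nat \<Rightarrow> real" where
  "delta N \<theta> i = wrap (\<theta> (vtx N (i + 1)) - \<theta> (vtx N i))"

definition winding :: "nat \<Rightarrow> (nat \<Rightarrow> real) \<Rightarrow> real" where
  "winding N \<theta> = 1 / (2 * pi) * (\<Sum>i=1..N. delta N \<theta> i)"

definition S_plus :: "nat \<Rightarrow> (nat \<Rightarrow> real) \<Rightarrow> nat \<Rightarrow> real" where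
  "S_plus N \<theta> k = delta N \<theta> (vtx N (k + 1)) + delta N \<theta> k / 2"

text \<open>Used for \<open>k \<ge> 1\<close> only, so the subtraction \<open>k - 1\<close> is exact; for \<open>k = 1\<close> the vertex is \<open>N\<close>.\<close>

definition S_minus :: "nat \<Rightarrow> (nat \<Rightarrow> real) \<Rightarrow> nat \<Rightarrow> real" where
  "S_minus N \<theta> k = delta N \<theta> (vtx N (k - 1)) + delta N \<theta> k / 2"

text \<open>Update of the edge \<open>(k, k + 1)\<close>. The coin \<open>c\<close> only matters in the tie \<open>delta N \<theta> k = - pi\<close>.\<close>

definition acca_step :: "nat \<Rightarrow> nat \<Rightarrow> bool \<Rightarrow> (nat \<Rightarrow> real) \<Rightarrow> (nat \<Rightarrow> real)" where
  "acca_step N k c \<theta> =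
    (if delta N \<theta> k = - pi
     then let v = (if c then wrap (\<theta> k + pi / 2) else wrap (\<theta> k - pi / 2))
          in \<theta>(k := v, vtx N (k + 1) := v)
     else \<theta>(k := wrap (\<theta> k + delta N \<theta> k / 2),
            vtx N (k + 1) := wrap (\<theta> (vtx N (k + 1)) - delta N \<theta> k / 2)))"

primrec acca :: "nat \<Rightarrow> (nat \<Rightarrow> real) \<Rightarrow> (nat \<Rightarrow> nat) \<Rightarrow> (nat \<Rightarrow> bool) \<Rightarrow> nat \<Rightarrow> nat \<Rightarrow> real" where
  "acca N \<theta>0 k c 0 = \<theta>0"
| "acca N \<theta>0 k c (Suc t) = acca_step N (k t) (c t) (acca N \<theta>0 k c t)"

text \<open>The pairs (edge, coin) used at times \<open>0, 1, 2, \<dots>\<close> are independent and uniformly distributed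
  on \<open>{1..N} \<times> UNIV\<close>: each edge is uniform and independent of the past, and independently of it
  and of the past a fair coin is available for resolving a tie.\<close>

definition acca_driving ::
  "'w measure \<Rightarrow> nat \<Rightarrow> (nat \<Rightarrow> 'w \<Rightarrow> nat) \<Rightarrow> (nat \<Rightarrow> 'w \<Rightarrow> bool) \<Rightarrow> bool" where
  "acca_driving M N K C \<longleftrightarrow>
     prob_space.indep_vars M (\<lambda>_. count_space ({1..N} \<times> UNIV)) (\<lambda>t \<omega>. (K t \<omega>, C t \<omega>)) UNIV \<and>
     (\<forall>t. distr M (count_space ({1..N} \<times> UNIV)) (\<lambda>\<omega>. (K t \<omega>, C t \<omega>)) =
          uniform_count_measure ({1..N} \<times> UNIV))"

definition singular :: "nat \<Rightarrow> (nat \<Rightarrow> real) \<Rightarrow> bool" where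
  "singular N \<theta> \<longleftrightarrow>
     (\<exists>k\<in>{1..N}. S_minus N \<theta> k \<notin> {-pi<..<pi} \<or> S_plus N \<theta> k \<notin> {-pi<..<pi} \<or> delta N \<theta> k = - pi)"

definition first_singular_time :: "nat \<Rightarrow> (nat \<Rightarrow> nat \<Rightarrow> real) \<Rightarrow> enat" where
  "first_singular_time N \<theta> = Inf (enat ` {t. singular N (\<theta> t)})"

definition is_lift :: "nat \<Rightarrow> (nat \<Rightarrow> real) \<Rightarrow> (nat \<Rightarrow> real) \<Rightarrow> bool" where
  "is_lift N \<theta> \<eta> \<longleftrightarrow> (\<forall>i\<in>{1..N}. \<eta> (i + 1) - \<eta> i = delta N \<theta> i) \<and> wrap (\<eta> 1) = \<theta> 1"

text \<open>For \<open>t\<close> before the first singular time, these equations determine \<open>\<eta> (t + 1)\<close> on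
  \<open>{1..N + 1}\<close> from \<open>\<eta> t\<close>; nothing is required afterwards.\<close>

definition lifted_representation ::
  "nat \<Rightarrow> (nat \<Rightarrow> nat) \<Rightarrow> (nat \<Rightarrow> nat \<Rightarrow> real) \<Rightarrow> (nat \<Rightarrow> real) \<Rightarrow> (nat \<Rightarrow> nat \<Rightarrow> real) \<Rightarrow> bool" where
  "lifted_representation N k \<theta> \<eta>0 \<eta> \<longleftrightarrow>
     (\<forall>i\<in>{1..N + 1}. \<eta> 0 i = \<eta>0 i) \<and>
     (\<forall>t. enat t < first_singular_time N \<theta> \<longrightarrow>
        \<eta> (t + 1) (k t) = (\<eta> t (k t) + \<eta> t (k t + 1)) / 2 \<and>
        \<eta> (t + 1) (k t + 1) = (\<eta> t (k t) + \<eta> t (k t + 1)) / 2 \<and>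
        (\<forall>i\<in>{1..N}. \<eta> (t + 1) (i + 1) - \<eta> (t + 1) i = delta N (\<theta> (t + 1)) i))"

primrec compensator :: "nat \<Rightarrow> real \<Rightarrow> (nat \<Rightarrow> nat) \<Rightarrow> nat \<Rightarrow> nat \<Rightarrow> real" where
  "compensator N \<beta> k 0 = (\<lambda>_. 0)"
| "compensator N \<beta> k (Suc t) =
    (let s = compensator N \<beta> k t; m = (s (k t) + s (vtx N (k t + 1))) / 2
     in s(k t := m + \<beta> / 2, vtx N (k t + 1) := m - \<beta> / 2))"

text \<open>\<open>vtx\<close> implements the convention that the compensator at \<open>N + 1\<close> is the one at \<open>1\<close>.\<close>

definition detrended :: "nat \<Rightarrow> real \<Rightarrow> (nat \<Rightarrow> real) \<Rightarrow> (nat \<Rightarrow> real) \<Rightarrow> nat \<Rightarrow> real" where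
  "detrended N \<beta> \<eta> s i = \<eta> i - \<beta> * (real i - 1) - s (vtx N i)"

end

theory Submission
  imports Defs "HOL-Library.Real_Mod"
begin

text \<open>
  Off the singular set no wrapping occurs in the increments next to the updated edge, so the lift
  extended by \<open>\<eta> (i + N) = \<eta> i + 2 \<pi> W\<close> is simply averaged across that edge. Subtracting the linear
  profile \<open>\<beta> (i - 1)\<close> and the compensator removes both the slope and the jump at the seam, and the
  detrended process becomes the pairwise averaging process on the cycle. The mean is conserved, the
  range of values never grows, and whenever the edges \<open>1, \<dots>, N - 1\<close> are chosen in this order the value
  at vertex 1 is spread over the whole ring, so that the range shrinks by the factor
  \<open>1 - 2 ^ -(N - 1)\<close>. Independence makes such sweeps occur infinitely often almost surely.
\<close>

section \<open>Recurrence of patterns in independent sequences\<close>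

text \<open>The second Borel-Cantelli lemma for events of constant probability: by independence,
  avoiding all of them from index \<open>n0\<close> to \<open>n0 + m\<close> has probability
  \<open>(1 - p) ^ Suc m\<close>, which tends to 0 as \<open>m\<close> grows.\<close>

lemma (in prob_space) AE_INFM_indep:
  fixes Z :: "nat \<Rightarrow> 'a \<Rightarrow> bool"
  assumes ind: "indep_vars (\<lambda>_. count_space UNIV) Z UNIV"
    and p: "0 < p" "\<And>n. prob {\<omega> \<in> space M. Z n \<omega>} = p"
  shows "AE \<omega> in M. \<exists>\<^sub>\<infinity>n. Z n \<omega>"
proof -
  have Z[measurable]: "Z n \<in> measurable M (count_space UNIV)" for n
    using ind by (auto simp: indep_vars_def)
  have compl: "prob (Z n -` {False} \<inter> space M) = 1 - p" for n
  proof -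
    have "Z n -` {False} \<inter> space M = space M - {\<omega> \<in> space M. Z n \<omega>}" by auto
    then show ?thesis using p(2)[of n] by (simp add: prob_compl)
  qed
  have "p \<le> 1" using p(2)[of 0] prob_le_1 by metis
  have "AE \<omega> in M. \<exists>n\<ge>n0. Z n \<omega>" for n0
  proof -
    let ?B = "{\<omega> \<in> space M. \<forall>n\<ge>n0. \<not> Z n \<omega>}"
    have "prob ?B \<le> (1 - p) ^ Suc m" for m
    proof -
      have "prob ?B \<le> prob (\<Inter>n\<in>{n0..n0 + m}. Z n -` {False} \<inter> space M)"
      proof (rule finite_measure_mono)
        show "(\<Inter>n\<in>{n0..n0 + m}. Z n -` {False} \<inter> space M) \<in> events"
          by (intro sets.finite_INT measurable_sets[OF Z]) auto
        show "?B \<subseteq> (\<Inter>n\<in>{n0..n0 + m}. Z n -` {False} \<inter> space M)"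
        proof
          fix \<omega> assume "\<omega> \<in> ?B"
          then show "\<omega> \<in> (\<Inter>n\<in>{n0..n0 + m}. Z n -` {False} \<inter> space M)" by simp
        qed
      qed
      also have "\<dots> = (\<Prod>n\<in>{n0..n0 + m}. prob (Z n -` {False} \<inter> space M))"
        by (intro indep_varsD[OF ind]) auto
      also have "\<dots> = (1 - p) ^ Suc m" by (simp add: compl)
      finally show ?thesis .
    qed
    moreover have "(\<lambda>m. (1 - p) ^ Suc m) \<longlonglongrightarrow> 0"
      using p(1) \<open>p \<le> 1\<close> by (intro LIMSEQ_Suc LIMSEQ_power_zero) auto
    ultimately have "prob ?B \<le> 0"
      by (intro LIMSEQ_le_const) auto
    then have "prob ?B = 0" by (simp add: measure_le_0_iff)
    then have "AE \<omega> in M. \<omega> \<notin> ?B"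
      by (intro AE_not_in) (auto simp: null_sets_def emeasure_eq_measure)
    then show ?thesis using AE_space by eventually_elim auto
  qed
  then have "AE \<omega> in M. \<forall>n0. \<exists>n\<ge>n0. Z n \<omega>" by (simp add: AE_all_countable)
  then show ?thesis by (simp add: INFM_nat_le)
qed

text \<open>Time is cut into consecutive blocks of length \<open>L\<close>. Disjoint blocks are
  independent, and each matches the pattern with the same probability \<open>q ^ L > 0\<close>, so
  the previous lemma applies to the matching events.\<close>

lemma (in prob_space) AE_INFM_pattern:
  fixes X :: "nat \<Rightarrow> 'a \<Rightarrow> 'b" and a :: "nat \<Rightarrow> 'b"
  assumes ind: "indep_vars (\<lambda>_. count_space UNIV) X UNIV"
    and L: "0 < L"
    and q: "0 < q" "\<And>t j. j < L \<Longrightarrow> prob {\<omega> \<in> space M. X t \<omega> = a j} = q"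
  shows "AE \<omega> in M. \<exists>\<^sub>\<infinity>n. \<forall>j<L. X (n * L + j) \<omega> = a j"
proof (rule AE_INFM_indep)
  let ?I = "\<lambda>n. {n * L..<n * L + L}"
  let ?Y = "\<lambda>n (f :: nat \<Rightarrow> 'b). \<forall>j<L. f (n * L + j) = a j"
  have "disjoint_family ?I"
    unfolding disjoint_family_on_def
  proof safe
    fix m n x assume "m \<noteq> n" "x \<in> ?I m" "x \<in> ?I n"
    moreover have "x div L = j" if "x \<in> ?I j" for j
      using that by (intro div_nat_eqI) (simp_all add: mult.commute)
    ultimately have "x div L = m" "x div L = n" by blast+
    then show "x \<in> {}" using \<open>m \<noteq> n\<close> by simp
  qed
  then have "indep_vars (\<lambda>n. PiM (?I n) (\<lambda>_. count_space UNIV))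
      (\<lambda>n \<omega>. restrict (\<lambda>i. X i \<omega>) (?I n)) UNIV"
    by (intro indep_vars_restrict[OF ind]) auto
  moreover have "?Y n \<in> measurable (PiM (?I n) (\<lambda>_. count_space UNIV)) (count_space UNIV)" for n
  proof -
    have *: "(\<lambda>f. f (n * L + j) = a j)
        \<in> measurable (PiM (?I n) (\<lambda>_. count_space UNIV)) (count_space UNIV)" if "j < L" for j
      by (rule measurable_compose[OF measurable_component_singleton]) (use that in auto)
    have "(\<lambda>f. \<forall>j\<in>{..<L}. f (n * L + j) = a j)
        \<in> measurable (PiM (?I n) (\<lambda>_. count_space UNIV)) (count_space UNIV)"
      by (rule pred_intros_finite(3)) (auto intro: *)
    then show ?thesis by (simp add: Ball_def)
  qed
  ultimately have "indep_vars (\<lambda>_. count_space UNIV)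
      (\<lambda>n \<omega>. ?Y n (restrict (\<lambda>i. X i \<omega>) (?I n))) UNIV"
    by (rule indep_vars_compose2)
  then show "indep_vars (\<lambda>_. count_space UNIV) (\<lambda>n \<omega>. \<forall>j<L. X (n * L + j) \<omega> = a j) UNIV"
    by simp
  show "0 < q ^ L" using q(1) by simp
  show "prob {\<omega> \<in> space M. \<forall>j<L. X (n * L + j) \<omega> = a j} = q ^ L" for n
  proof -
    \<comment> \<open>The event is rewritten as an intersection over the block, the form in which
      independence turns its probability into a product.\<close>
    have "{\<omega> \<in> space M. \<forall>j<L. X (n * L + j) \<omega> = a j}
        = (\<Inter>t\<in>?I n. X t -` {a (t - n * L)} \<inter> space M)" (is "?A = ?B")
    proof (intro set_eqI iffI)
      fix x assume x: "x \<in> ?B"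
      have "X (n * L + j) x = a j" if "j < L" for j
      proof -
        have "n * L + j \<in> ?I n" using that by auto
        with x have "x \<in> X (n * L + j) -` {a (n * L + j - n * L)}" by blast
        then show ?thesis by simp
      qed
      \<comment> \<open>Membership in \<open>space M\<close> is read off from one factor of the
        intersection, so the block must be nonempty.\<close>
      moreover have "n * L \<in> ?I n" using L by auto
      ultimately show "x \<in> ?A" using x by blast
    next
      fix x assume x: "x \<in> ?A"
      show "x \<in> ?B"
      proof
        fix t assume "t \<in> ?I n"
        then have "t - n * L < L" "n * L + (t - n * L) = t" by auto
        moreover from x this(1) have "X (n * L + (t - n * L)) x = a (t - n * L)" by blast
        ultimately show "x \<in> X t -` {a (t - n * L)} \<inter> space M" using x by simp
      qed
    qed
    then have "prob ?A = prob ?B" by simp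
    also have "\<dots> = (\<Prod>t\<in>?I n. prob (X t -` {a (t - n * L)} \<inter> space M))"
      using L by (intro indep_varsD[OF ind]) auto
    also have "\<dots> = (\<Prod>t\<in>?I n. q)"
    proof (rule prod.cong)
      fix t assume "t \<in> ?I n"
      then have "t - n * L < L" by auto
      moreover have "X t -` {b} \<inter> space M = {\<omega> \<in> space M. X t \<omega> = b}" for b by auto
      ultimately show "prob (X t -` {a (t - n * L)} \<inter> space M) = q" using q(2) by simp
    qed simp
    finally show ?thesis by simp
  qed
qed

section \<open>Consequences for the edges chosen by the dynamics\<close>

text \<open>The pattern is the increasing sweep over all edges except the seam edge
  \<open>N\<close>. Projecting away the coins keeps independence, and every edge has probability
  \<open>2 / (2 * N)\<close> at each time.\<close>

lemma AE_INFM_sweep: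
  assumes "prob_space M" "N \<ge> 2" "acca_driving M N K C"
  shows "AE \<omega> in M. \<exists>\<^sub>\<infinity>n. \<forall>j<N - 1. K (n * (N - 1) + j) \<omega> = Suc j"
proof -
  interpret prob_space M by fact
  let ?E = "{1..N} \<times> (UNIV :: bool set)"
  have ind: "indep_vars (\<lambda>_. count_space ?E) (\<lambda>t \<omega>. (K t \<omega>, C t \<omega>)) UNIV"
    and unif: "distr M (count_space ?E) (\<lambda>\<omega>. (K t \<omega>, C t \<omega>)) = uniform_count_measure ?E" for t
    using assms(3) by (auto simp: acca_driving_def)
  have rv: "(\<lambda>\<omega>. (K t \<omega>, C t \<omega>)) \<in> measurable M (count_space ?E)" for t
    using ind by (auto simp: indep_vars_def)
  show ?thesis
  proof (rule AE_INFM_pattern)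
    show "indep_vars (\<lambda>_. count_space UNIV) K UNIV"
      using indep_vars_compose2[OF ind, of "\<lambda>_. fst" "\<lambda>_. count_space UNIV"] by simp
    show "0 < N - 1" "0 < 1 / real N" using assms(2) by auto
    show "prob {\<omega> \<in> space M. K t \<omega> = Suc j} = 1 / real N" if "j < N - 1" for t j
    proof -
      have sub: "{Suc j} \<times> UNIV \<subseteq> ?E" using that by auto
      have "{\<omega> \<in> space M. K t \<omega> = Suc j} = (\<lambda>\<omega>. (K t \<omega>, C t \<omega>)) -` ({Suc j} \<times> UNIV) \<inter> space M"
        by auto
      then have "prob {\<omega> \<in> space M. K t \<omega> = Suc j}
          = measure (distr M (count_space ?E) (\<lambda>\<omega>. (K t \<omega>, C t \<omega>))) ({Suc j} \<times> UNIV)"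
        using sub by (subst measure_distr[OF rv]) auto
      also have "\<dots> = card ({Suc j} \<times> (UNIV :: bool set)) / card ?E"
        unfolding unif using sub by (intro measure_uniform_count_measure) auto
      finally show ?thesis by (simp add: card_cartesian_product)
    qed
  qed
qed

text \<open>Measurability into a space whose carrier is \<open>{1..N} \<times> UNIV\<close>
  restricts the values at every sample point, not merely almost everywhere.\<close>

lemma acca_driving_range:
  assumes "prob_space M" "acca_driving M N K C" "\<omega> \<in> space M"
  shows "K t \<omega> \<in> {1..N}"
proof -
  interpret prob_space M by fact
  have "(\<lambda>\<omega>. (K t \<omega>, C t \<omega>)) \<in> measurable M (count_space ({1..N} \<times> UNIV))"
    using assms(2) by (auto simp: acca_driving_def indep_vars_def)
  from measurable_space[OF this assms(3)] show ?thesis by simp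
qed

section \<open>Pairwise averaging on the cycle\<close>

lemma vtx_id: "i \<in> {1..N} \<Longrightarrow> vtx N i = i"
  by (cases "i = N") (auto simp: vtx_def)

lemma vtx_in: "N \<ge> 1 \<Longrightarrow> vtx N i \<in> {1..N}"
  by (auto simp: vtx_def)

lemma vtx_Suc: "i \<in> {1..N} \<Longrightarrow> vtx N (Suc i) = (if i = N then 1 else Suc i)"
  by (cases "N = 1") (auto simp: vtx_def mod_Suc)

definition gossip_step :: "nat \<Rightarrow> nat \<Rightarrow> (nat \<Rightarrow> real) \<Rightarrow> nat \<Rightarrow> real" where
  "gossip_step N k z i =
    (if i = k \<or> i = vtx N (Suc k) then (z k + z (vtx N (Suc k))) / 2 else z i)"

lemma sum_gossip_step:
  assumes "N \<ge> 2" "k \<in> {1..N}"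
  shows "(\<Sum>i=1..N. gossip_step N k z i) = (\<Sum>i=1..N. z i)"
proof -
  define v where "v = vtx N (Suc k)"
  \<comment> \<open>The amount that the update transfers from \<open>v\<close> to \<open>k\<close>;
    it cancels in the sum because \<open>v\<close> and \<open>k\<close> are distinct.\<close>
  define d where "d = (z v - z k) / 2"
  have v: "v \<in> {1..N}" "v \<noteq> k" using assms by (auto simp: v_def vtx_Suc)
  have "gossip_step N k z i = z i + (if i = k then d else 0) - (if i = v then d else 0)" for i
    using v by (auto simp: gossip_step_def v_def[symmetric] d_def field_simps)
  then show ?thesis
    using v assms(2) by (simp add: sum.distrib sum_subtractf)
qed

lemma gossip_step_bounds:
  assumes "N \<ge> 2" "k \<in> {1..N}" "i \<in> {1..N}" "\<And>i. i \<in> {1..N} \<Longrightarrow> z i \<in> {lo..hi}"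
  shows "gossip_step N k z i \<in> {lo..hi}"
  using assms(4)[OF assms(2)] assms(4)[of "vtx N (Suc k)"] assms(4)[OF assms(3)] assms(1) vtx_in[of N]
  by (auto simp: gossip_step_def)

text \<open>The deterministic half of the argument: between sweeps the updates are arbitrary and
  cannot widen an enclosing interval, and each sweep contracts it by the fixed factor
  \<open>r < 1\<close>.\<close>

lemma gossip_consensus:
  fixes z :: "nat \<Rightarrow> nat \<Rightarrow> real" and k :: "nat \<Rightarrow> nat"
  assumes N: "N \<ge> 2" and k: "\<And>t. k t \<in> {1..N}"
    and step: "\<And>t i. i \<in> {1..N} \<Longrightarrow> z (Suc t) i = gossip_step N (k t) (z t) i"
    and sweep: "\<exists>\<^sub>\<infinity>n. \<forall>j<N - 1. k (n * (N - 1) + j) = Suc j"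
  shows "\<exists>\<alpha>. (\<lambda>t. MAX i\<in>{1..N}. \<bar>z t i - \<alpha>\<bar>) \<longlonglongrightarrow> 0"
proof -
  define \<alpha> where "\<alpha> = (\<Sum>i=1..N. z 0 i) / N"
  define r where "r = 1 - (1 / 2 :: real) ^ (N - 1)"
  have r: "0 \<le> r" "r < 1" by (auto simp: r_def power_le_one)
  have sum_eq: "(\<Sum>i=1..N. z t i) = N * \<alpha>" for t
  proof (induction t)
    case 0
    then show ?case using N by (simp add: \<alpha>_def)
  next
    case (Suc t)
    have "(\<Sum>i=1..N. z (Suc t) i) = (\<Sum>i=1..N. gossip_step N (k t) (z t) i)"
      by (intro sum.cong) (auto simp: step)
    then show ?case using Suc sum_gossip_step[OF N k] by simp
  qed
  \<comment> \<open>The conserved mean lies in every enclosing interval, which identifies the limit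
    once these intervals become short.\<close>
  have mean: "\<alpha> \<in> {lo..hi}" if "\<And>i. i \<in> {1..N} \<Longrightarrow> z t i \<in> {lo..hi}" for t lo hi
  proof -
    have "N * lo \<le> N * \<alpha>" "N * \<alpha> \<le> N * hi"
      using sum_bounded_below[of "{1..N}" lo "z t"] sum_bounded_above[of "{1..N}" "z t" hi]
        that sum_eq[of t] by auto
    then show ?thesis using N by auto
  qed
  have stay: "z t i \<in> {lo..hi}"
    if "T \<le> t" "i \<in> {1..N}" and T: "\<And>i. i \<in> {1..N} \<Longrightarrow> z T i \<in> {lo..hi}" for T t i lo hi
    using that(1,2)
  proof (induction t arbitrary: i rule: dec_induct)
    case base
    then show ?case by (rule T)
  next
    case (step t)
    then have "gossip_step N (k t) (z t) i \<in> {lo..hi}"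
      by (intro gossip_step_bounds[OF N k]) auto
    then show ?case using assms(3) step.prems by simp
  qed
  have contract: "\<exists>lo' hi'. hi' - lo' = r * (hi - lo) \<and>
      (\<forall>i\<in>{1..N}. z (T + (N - 1)) i \<in> {lo'..hi'})"
    if T: "\<And>i. i \<in> {1..N} \<Longrightarrow> z T i \<in> {lo..hi}" and kT: "\<And>j. j < N - 1 \<Longrightarrow> k (T + j) = Suc j"
    for T lo hi
  proof -
    define c where "c = z T 1"
    \<comment> \<open>Both bounds start at \<open>c\<close> and move half of the remaining way to
      \<open>lo\<close> and \<open>hi\<close> with each update. The width \<open>h j - l j\<close>
      equals \<open>(1 - (1 / 2) ^ j) * (hi - lo)\<close> whatever \<open>c\<close> is, which
      explains \<open>r\<close>.\<close>
    define l where "l j = lo + (c - lo) * (1 / 2) ^ j" for j :: nat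
    define h where "h j = hi - (hi - c) * (1 / 2) ^ j" for j :: nat
    have c: "lo \<le> c" "c \<le> hi" using T[of 1] N by (auto simp: c_def)
    have lh_Suc: "l (Suc j) = (l j + lo) / 2" "h (Suc j) = (h j + hi) / 2" for j
      by (auto simp: l_def h_def field_simps)
    have lh: "lo \<le> l j" "h j \<le> hi" for j
      using c by (auto simp: l_def h_def)
    \<comment> \<open>Update \<open>j\<close> of the sweep averages vertex \<open>Suc j\<close>,
      already controlled by \<open>l j\<close> and \<open>h j\<close>, with the next vertex, known
      only to lie in \<open>{lo..hi}\<close>.\<close>
    have "z (T + j) i \<in> {l j..h j}" if "j \<le> N - 1" "i \<in> {1..Suc j}" for j i
      using that
    proof (induction j arbitrary: i)
      case 0
      then show ?case by (simp add: l_def h_def c_def)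
    next
      case (Suc j)
      have j: "k (T + j) = Suc j" "Suc j \<in> {1..N}" "vtx N (Suc (Suc j)) = Suc (Suc j)"
        using Suc.prems kT by (auto intro: vtx_id)
      have i: "i \<in> {1..N}" using Suc.prems by auto
      have new: "z (T + j) (Suc (Suc j)) \<in> {lo..hi}"
        using Suc.prems stay[OF _ _ T, of "T + j" "Suc (Suc j)"] by auto
      have old: "z (T + j) i' \<in> {l j..h j}" if "i' \<in> {1..Suc j}" for i'
        using Suc that by auto
      show ?case
      proof (cases "i = Suc j \<or> i = Suc (Suc j)")
        case True
        then have "z (T + Suc j) i = (z (T + j) (Suc j) + z (T + j) (Suc (Suc j))) / 2"
          using step[OF i, of "T + j"] j by (auto simp: gossip_step_def)
        then show ?thesis using old[of "Suc j"] new by (auto simp: lh_Suc)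
      next
        case False
        then have "z (T + Suc j) i = z (T + j) i"
          using step[OF i, of "T + j"] j by (auto simp: gossip_step_def)
        \<comment> \<open>Untouched vertices keep their bound because the intervals
          \<open>{l j..h j}\<close> grow with \<open>j\<close>.\<close>
        then show ?thesis using old[of i] False Suc.prems lh[of j] by (auto simp: lh_Suc)
      qed
    qed
    from this[of "N - 1"] have "\<forall>i\<in>{1..N}. z (T + (N - 1)) i \<in> {l (N - 1)..h (N - 1)}"
      using N by auto
    moreover have "h (N - 1) - l (N - 1) = r * (hi - lo)"
      by (simp add: h_def l_def r_def algebra_simps)
    ultimately show ?thesis by blast
  qed
  define lo0 where "lo0 = Min (z 0 ` {1..N})"
  define hi0 where "hi0 = Max (z 0 ` {1..N})"
  have shrink: "\<exists>T lo hi. hi - lo = r ^ n * (hi0 - lo0) \<and> (\<forall>i\<in>{1..N}. z T i \<in> {lo..hi})" for n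
  proof (induction n)
    case 0
    have "\<forall>i\<in>{1..N}. z 0 i \<in> {lo0..hi0}" by (auto simp: lo0_def hi0_def)
    then show ?case by (intro exI[of _ 0] exI[of _ lo0] exI[of _ hi0]) simp
  next
    case (Suc n)
    then obtain T lo hi where *: "hi - lo = r ^ n * (hi0 - lo0)" "\<forall>i\<in>{1..N}. z T i \<in> {lo..hi}"
      by blast
    \<comment> \<open>Blocks have length at least 1, so block \<open>m\<close> starts no earlier
      than time \<open>m\<close>, hence not before \<open>T\<close>.\<close>
    obtain m where m: "m \<ge> T" "\<forall>j<N - 1. k (m * (N - 1) + j) = Suc j"
      using sweep unfolding INFM_nat_le by blast
    have "T \<le> m * (N - 1)" using mult_le_mono[of T m 1 "N - 1"] m(1) N by simp
    then have "\<exists>lo' hi'. hi' - lo' = r * (hi - lo) \<and>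
        (\<forall>i\<in>{1..N}. z (m * (N - 1) + (N - 1)) i \<in> {lo'..hi'})"
      using * m(2) stay[of T "m * (N - 1)" _ lo hi] by (intro contract) auto
    then show ?case using *(1) by (metis mult.assoc power_Suc)
  qed
  have "(\<lambda>t. MAX i\<in>{1..N}. \<bar>z t i - \<alpha>\<bar>) \<longlonglongrightarrow> 0"
  proof (rule LIMSEQ_I)
    fix e :: real assume "e > 0"
    have "(\<lambda>n. r ^ n * (hi0 - lo0)) \<longlonglongrightarrow> 0 * (hi0 - lo0)"
      using r by (intro tendsto_intros LIMSEQ_power_zero) auto
    then have "\<forall>\<^sub>F n in sequentially. r ^ n * (hi0 - lo0) < e"
      using \<open>e > 0\<close> by (intro order_tendstoD) auto
    then obtain n where n: "r ^ n * (hi0 - lo0) < e"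
      by (auto simp: eventually_sequentially)
    obtain T lo hi where T: "hi - lo = r ^ n * (hi0 - lo0)" "\<forall>i\<in>{1..N}. z T i \<in> {lo..hi}"
      using shrink by blast
    show "\<exists>T. \<forall>t\<ge>T. norm ((MAX i\<in>{1..N}. \<bar>z t i - \<alpha>\<bar>) - 0) < e"
    proof (intro exI allI impI)
      fix t assume "t \<ge> T"
      have "\<alpha> \<in> {lo..hi}" using mean T(2) by blast
      then have less: "\<bar>z t i - \<alpha>\<bar> < e" if "i \<in> {1..N}" for i
        using stay[OF \<open>t \<ge> T\<close> that, of lo hi] T n by auto
      have "(MAX i\<in>{1..N}. \<bar>z t i - \<alpha>\<bar>) \<in> (\<lambda>i. \<bar>z t i - \<alpha>\<bar>) ` {1..N}"
        using N by (intro Max_in) auto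
      then show "norm ((MAX i\<in>{1..N}. \<bar>z t i - \<alpha>\<bar>) - 0) < e"
        using less by auto
    qed
  qed
  then show ?thesis by blast
qed

section \<open>The lift before the first singular time\<close>

lemma wrap_rcong: "[wrap a = a] (rmod (2 * pi))"
  unfolding rcong_altdef wrap_def
  by (rule exI[of _ "\<lfloor>(a + pi) / (2 * pi)\<rfloor>"]) simp

lemma wrap_range: "wrap a \<in> {-pi..<pi}"
proof -
  define x where "x = (a + pi) / (2 * pi)"
  have "a = 2 * pi * x - pi" by (simp add: x_def)
  moreover have "2 * pi * of_int \<lfloor>x\<rfloor> \<le> 2 * pi * x" "2 * pi * x < 2 * pi * (of_int \<lfloor>x\<rfloor> + 1)"
    by (auto simp: mult_strict_left_mono)
  ultimately show ?thesis by (simp add: wrap_def x_def[symmetric] algebra_simps)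
qed

text \<open>Two congruent points of a half-open window of length 2 pi coincide. This reduces the
  computation of a wrapped increment to a congruence and a range check.\<close>

lemma wrap_unique:
  assumes "[a = b] (rmod (2 * pi))" "b \<in> {-pi..<pi}"
  shows "wrap a = b"
proof (rule rcong_imp_eq)
  show "[wrap a = b] (rmod (2 * pi))" using wrap_rcong assms(1) by (rule rcong_trans)
  show "\<bar>wrap a - b\<bar> < \<bar>2 * pi\<bar>" using wrap_range[of a] assms(2) by auto
qed

text \<open>Wrapping does not change residues, so the increments of the lift sum up to those of the
  configuration modulo 2 pi. At \<open>i = N + 1\<close> the comparison is with vertex 1.\<close>

lemma lift_rcong:
  assumes "N \<ge> 1"
    and inc: "\<And>i. i \<in> {1..N} \<Longrightarrow> \<eta> (Suc i) - \<eta> i = delta N \<theta> i"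
    and base: "[\<eta> 1 = \<theta> 1] (rmod (2 * pi))" and i: "i \<in> {1..N + 1}"
  shows "[\<eta> i = \<theta> (vtx N i)] (rmod (2 * pi))"
proof -
  from i have "1 \<le> i" "i \<le> N + 1" by auto
  then show ?thesis
  proof (induction i rule: dec_induct)
    case base
    then show ?case using assms by (simp add: vtx_id)
  next
    case (step i)
    have "[\<eta> i + delta N \<theta> i = \<theta> (vtx N i) + (\<theta> (vtx N (Suc i)) - \<theta> (vtx N i))] (rmod (2 * pi))"
      using step by (intro rcong_add) (auto simp: delta_def wrap_rcong)
    moreover have "\<eta> (Suc i) = \<eta> i + delta N \<theta> i" using inc[of i] step by auto
    ultimately show ?case by simp
  qed
qed

text \<open>For \<open>N = 2\<close> the two neighbouring edges coincide and \<open>S_plus\<close>, \<open>S_minus\<close> do not describe the new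
  increment, whence the case where both indicators are active.\<close>

lemma lift_step:
  fixes \<theta> \<eta> :: "nat \<Rightarrow> real"
  assumes N: "N \<ge> 2" and k: "k \<in> {1..N}" and ns: "\<not> singular N \<theta>"
    and inc: "\<And>i. i \<in> {1..N} \<Longrightarrow> \<eta> (Suc i) - \<eta> i = delta N \<theta> i"
    and cong: "\<And>i. i \<in> {1..N + 1} \<Longrightarrow> [\<eta> i = \<theta> (vtx N i)] (rmod (2 * pi))"
  defines "d \<equiv> delta N \<theta> k"
  defines "\<eta>' \<equiv> \<lambda>i. \<eta> i + (if vtx N i = k then d / 2 else 0) - (if vtx N i = vtx N (Suc k) then d / 2 else 0)"
  shows "\<And>i. i \<in> {1..N + 1} \<Longrightarrow> [\<eta>' i = acca_step N k c \<theta> (vtx N i)] (rmod (2 * pi))"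
    and "\<And>i. i \<in> {1..N} \<Longrightarrow> \<eta>' (Suc i) - \<eta>' i = delta N (acca_step N k c \<theta>) i"
proof -
  define \<theta>' where "\<theta>' = acca_step N k c \<theta>"
  define v where "v = vtx N (Suc k)"
  have v: "v \<in> {1..N}" "v \<noteq> k" using N k by (auto simp: v_def vtx_Suc)
  \<comment> \<open>Since the value \<open>-pi\<close> is excluded, the tie branch of
    \<open>acca_step\<close> is not taken and the coin has no influence.\<close>
  have nd: "delta N \<theta> i \<in> {-pi<..<pi}" if "i \<in> {1..N}" for i
  proof -
    have "delta N \<theta> i \<noteq> -pi" using ns that by (auto simp: singular_def)
    then show ?thesis using wrap_range[of "\<theta> (vtx N (i + 1)) - \<theta> (vtx N i)"]
      by (auto simp: delta_def)
  qed
  have \<theta>': "\<theta>' = \<theta>(k := wrap (\<theta> k + d / 2), v := wrap (\<theta> v - d / 2))"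
    using nd[OF k] by (auto simp: \<theta>'_def acca_step_def d_def v_def)
  show c': "[\<eta>' i = acca_step N k c \<theta> (vtx N i)] (rmod (2 * pi))" if "i \<in> {1..N + 1}" for i
  proof -
    have *: "[\<eta> i = \<theta> (vtx N i)] (rmod (2 * pi))" by (rule cong[OF that])
    have "[\<eta> i + d / 2 = wrap (\<theta> k + d / 2)] (rmod (2 * pi))" if "vtx N i = k"
      using rcong_trans[OF rcong_add[OF * rcong_refl] rcong_sym[OF wrap_rcong]] that by simp
    moreover have "[\<eta> i - d / 2 = wrap (\<theta> v - d / 2)] (rmod (2 * pi))" if "vtx N i = v"
      using rcong_trans[OF rcong_diff[OF * rcong_refl] rcong_sym[OF wrap_rcong]] that by simp
    ultimately show ?thesis using * v(2)
      unfolding \<theta>'_def[symmetric] \<theta>' \<eta>'_def v_def[symmetric] by auto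
  qed
  show "\<eta>' (Suc i) - \<eta>' i = delta N (acca_step N k c \<theta>) i" if i: "i \<in> {1..N}" for i
  proof -
    have "[\<eta>' (Suc i) - \<eta>' i = \<theta>' (vtx N (Suc i)) - \<theta>' (vtx N i)] (rmod (2 * pi))"
      unfolding \<theta>'_def using i by (intro rcong_diff c') auto
    then have cong_i: "[\<theta>' (vtx N (Suc i)) - \<theta>' (vtx N i) = \<eta>' (Suc i) - \<eta>' i] (rmod (2 * pi))"
      by (rule rcong_sym)
    have vi: "vtx N i = i" using i by (rule vtx_id)
    have vSuc: "vtx N (Suc i) = v \<longleftrightarrow> i = k" using i k by (auto simp: v_def vtx_Suc)
    have eq: "\<eta>' (Suc i) - \<eta>' i = delta N \<theta> i + (if vtx N (Suc i) = k then d / 2 else 0)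
        + (if i = v then d / 2 else 0) - (if i = k then d else 0)"
      using inc[OF i] vSuc vi v(2) by (auto simp: \<eta>'_def v_def[symmetric])
    \<comment> \<open>The congruence is settled; what remains is that the averaged lift has
      increments inside the window, so that wrapping leaves them unchanged.\<close>
    have "\<eta>' (Suc i) - \<eta>' i \<in> {-pi..<pi}"
    proof (cases "i = k")
      case True
      have "vtx N (Suc i) \<noteq> k" using v True by (simp add: v_def)
      then have "\<eta>' (Suc i) - \<eta>' i = 0" using eq True v(2) by (simp add: d_def)
      then show ?thesis by simp
    next
      case False
      \<comment> \<open>Edge \<open>i\<close> is away from edge \<open>k\<close>, its left
        neighbour, its right neighbour, or both at once. For a single neighbour the new increment is
        \<open>S_minus\<close> or \<open>S_plus\<close> at \<open>k\<close>.\<close>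
      consider "vtx N (Suc i) \<noteq> k" "i \<noteq> v" | "vtx N (Suc i) = k" "i \<noteq> v"
        | "vtx N (Suc i) \<noteq> k" "i = v" | "vtx N (Suc i) = k" "i = v"
        by blast
      then show ?thesis
      proof cases
        case 1
        then show ?thesis using False nd[OF i] by (simp add: eq)
      next
        case 2
        have "vtx N (k - 1) = i"
          using 2(1) i k by (auto simp: vtx_Suc vtx_id split: if_splits) (simp add: vtx_def)
        moreover have "S_minus N \<theta> k \<in> {-pi<..<pi}" using ns k unfolding singular_def by blast
        ultimately show ?thesis using 2 False by (auto simp: eq S_minus_def d_def)
      next
        case 3
        have "S_plus N \<theta> k \<in> {-pi<..<pi}" using ns k unfolding singular_def by blast
        moreover have "S_plus N \<theta> k = delta N \<theta> i + d / 2"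
          using 3 by (simp add: S_plus_def d_def v_def)
        ultimately show ?thesis using eq 3 False by simp
      next
        case 4
        \<comment> \<open>Going around the two-edge cycle gives total increment 0 modulo 2 pi. Both
          terms lie strictly between \<open>-pi\<close> and \<open>pi\<close>, so the sum is exactly
          0.\<close>
        have "[delta N \<theta> i + delta N \<theta> k
            = (\<theta> (vtx N (Suc i)) - \<theta> (vtx N i)) + (\<theta> (vtx N (Suc k)) - \<theta> (vtx N k))] (rmod (2 * pi))"
          by (intro rcong_add) (auto simp: delta_def wrap_rcong)
        also have "(\<theta> (vtx N (Suc i)) - \<theta> (vtx N i)) + (\<theta> (vtx N (Suc k)) - \<theta> (vtx N k)) = 0"
          using 4 vi vtx_id[OF k] by (simp add: v_def)
        finally have "delta N \<theta> i + delta N \<theta> k = 0"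
          using nd[OF i] nd[OF k] by (intro rcong_imp_eq[of _ _ "2 * pi"]) auto
        then have "\<eta>' (Suc i) - \<eta>' i = 0" using eq 4 False by (simp add: d_def)
        then show ?thesis by simp
      qed
    qed
    from wrap_unique[OF cong_i this] show ?thesis by (simp add: delta_def \<theta>'_def)
  qed
qed

text \<open>The lifted representation prescribes all increments together with the value at the
  chosen edge; agreement in these data pins down the whole vector.\<close>

lemma eq_of_increments:
  fixes f g :: "nat \<Rightarrow> real"
  assumes "\<And>i. i \<in> {1..N} \<Longrightarrow> f (Suc i) - f i = g (Suc i) - g i"
    and "k \<in> {1..N + 1}" "f k = g k" "i \<in> {1..N + 1}"
  shows "f i = g i"
proof -
  have "f j - g j = f 1 - g 1" if "1 \<le> j" "j \<le> N + 1" for j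
    using that
  proof (induction j rule: dec_induct)
    case (step j)
    then show ?case using assms(1)[of j] by auto
  qed simp
  from this[of k] this[of i] show ?thesis using assms(2-4) by auto
qed

lemma first_singular_time_infinity:
  assumes "first_singular_time N \<theta> = \<infinity>"
  shows "\<not> singular N (\<theta> t)"
proof
  assume "singular N (\<theta> t)"
  then have "first_singular_time N \<theta> \<le> enat t"
    unfolding first_singular_time_def by (intro Inf_lower) auto
  then show False using assms by simp
qed

section \<open>Reduction of the detrended process to pairwise averaging\<close>

theorem theorem4p19:
  fixes M :: "'w measure" and N :: nat
    and \<theta>0 :: "nat \<Rightarrow> real" and \<theta> :: "'w \<Rightarrow> nat \<Rightarrow> nat \<Rightarrow> real"
    and K :: "nat \<Rightarrow> 'w \<Rightarrow> nat" and C :: "nat \<Rightarrow> 'w \<Rightarrow> bool"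
    and \<eta>0 :: "nat \<Rightarrow> real" and \<eta> :: "'w \<Rightarrow> nat \<Rightarrow> nat \<Rightarrow> real"
    and s :: "'w \<Rightarrow> nat \<Rightarrow> nat \<Rightarrow> real" and \<zeta> :: "'w \<Rightarrow> nat \<Rightarrow> nat \<Rightarrow> real" and \<beta> :: real
  assumes "prob_space M" and "N \<ge> 2"
    and "configuration N \<theta>0" and "acca_driving M N K C"
    and "\<And>\<omega>. \<omega> \<in> space M \<Longrightarrow> \<theta> \<omega> = acca N \<theta>0 (\<lambda>t. K t \<omega>) (\<lambda>t. C t \<omega>)"
    and "\<beta> = 2 * pi * winding N \<theta>0 / real N"
    and "is_lift N \<theta>0 \<eta>0"
    and "\<And>\<omega>. \<omega> \<in> space M \<Longrightarrow> lifted_representation N (\<lambda>t. K t \<omega>) (\<theta> \<omega>) \<eta>0 (\<eta> \<omega>)"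
    and "\<And>\<omega>. \<omega> \<in> space M \<Longrightarrow> s \<omega> = compensator N \<beta> (\<lambda>t. K t \<omega>)"
    and "\<And>\<omega> t. \<omega> \<in> space M \<Longrightarrow> \<zeta> \<omega> t = detrended N \<beta> (\<eta> \<omega> t) (s \<omega> t)"
  shows "AE \<omega> in M. first_singular_time N (\<theta> \<omega>) = \<infinity> \<longrightarrow>
           (\<exists>\<alpha>::real. (\<lambda>t. MAX i\<in>{1..N}. \<bar>\<zeta> \<omega> t i - \<alpha>\<bar>) \<longlonglongrightarrow> 0)"
  \<comment> \<open>Recurrence of sweeps is the only almost sure input; from here on the sample
    point is fixed and the argument is deterministic.\<close>
  using AE_INFM_sweep[OF assms(1,2,4)] AE_space
proof eventually_elim
  case (elim \<omega>)
  show ?case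
  proof
    assume inf: "first_singular_time N (\<theta> \<omega>) = \<infinity>"
    define k where "k t = K t \<omega>" for t
    note \<omega> = elim(2)
    have k: "k t \<in> {1..N}" for t
      unfolding k_def using acca_driving_range[OF assms(1,4) \<omega>] .
    have ns: "\<not> singular N (\<theta> \<omega> t)" for t
      using first_singular_time_infinity[OF inf] .
    have \<theta>_Suc: "\<theta> \<omega> (Suc t) = acca_step N (k t) (C t \<omega>) (\<theta> \<omega> t)" for t
      by (simp add: assms(5)[OF \<omega>] k_def)
    have \<eta>_0: "\<eta> \<omega> 0 i = \<eta>0 i" if "i \<in> {1..N + 1}" for i
      using assms(8)[OF \<omega>] that by (auto simp: lifted_representation_def)
    have \<eta>_Suc: "\<eta> \<omega> (Suc t) (k t) = (\<eta> \<omega> t (k t) + \<eta> \<omega> t (Suc (k t))) / 2"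
      and inc_Suc: "\<And>i. i \<in> {1..N} \<Longrightarrow> \<eta> \<omega> (Suc t) (Suc i) - \<eta> \<omega> (Suc t) i = delta N (\<theta> \<omega> (Suc t)) i" for t
      using assms(8)[OF \<omega>] inf by (auto simp: lifted_representation_def k_def)
    have inc: "\<eta> \<omega> t (Suc i) - \<eta> \<omega> t i = delta N (\<theta> \<omega> t) i" if "i \<in> {1..N}" for t i
    proof (cases t)
      case 0
      then show ?thesis using assms(7) that \<eta>_0 by (auto simp: is_lift_def assms(5)[OF \<omega>])
    qed (use inc_Suc that in auto)
    define d where "d t = delta N (\<theta> \<omega> t) (k t)" for t
    have v: "vtx N (Suc (k t)) \<in> {1..N}" "vtx N (Suc (k t)) \<noteq> k t" for t
      using assms(2) k[of t] by (auto simp: vtx_Suc)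
    \<comment> \<open>The step formula needs the congruence at time \<open>t\<close> and in turn
      yields it at time \<open>t + 1\<close>, so it is first stated conditionally. Testing
      \<open>vtx N i\<close> makes the copies 1 and \<open>N + 1\<close> of the seam vertex move
      together.\<close>
    have \<eta>_step: "\<eta> \<omega> (Suc t) i = \<eta> \<omega> t i + (if vtx N i = k t then d t / 2 else 0)
        - (if vtx N i = vtx N (Suc (k t)) then d t / 2 else 0)" (is "_ = ?\<eta>' i")
      if c: "\<forall>i\<in>{1..N + 1}. [\<eta> \<omega> t i = \<theta> \<omega> t (vtx N i)] (rmod (2 * pi))"
        and i: "i \<in> {1..N + 1}" for t i
    proof (rule eq_of_increments[where g = ?\<eta>'])
      show "\<eta> \<omega> (Suc t) (Suc j) - \<eta> \<omega> (Suc t) j = ?\<eta>' (Suc j) - ?\<eta>' j" if "j \<in> {1..N}" for j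
        unfolding inc_Suc[OF that] \<theta>_Suc d_def
        by (rule lift_step(2)[OF assms(2) k ns inc bspec[OF c] that, symmetric])
      show "k t \<in> {1..N + 1}" using k[of t] by auto
      show "\<eta> \<omega> (Suc t) (k t) = ?\<eta>' (k t)"
        using v[of t] \<eta>_Suc[of t] inc[OF k, of t t] vtx_id[OF k[of t]]
        by (auto simp: d_def field_simps)
    qed (rule i)
    have cong: "\<forall>i\<in>{1..N + 1}. [\<eta> \<omega> t i = \<theta> \<omega> t (vtx N i)] (rmod (2 * pi))" for t
    proof (induction t)
      case 0
      have "[\<eta>0 1 = \<theta>0 1] (rmod (2 * pi))"
        using assms(7) wrap_rcong[of "\<eta>0 1"] by (auto simp: is_lift_def intro: rcong_sym)
      then show ?case
        using lift_rcong[of N "\<eta> \<omega> 0" "\<theta> \<omega> 0"] inc assms(2) \<eta>_0[of 1] by (simp add: assms(5)[OF \<omega>])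
    next
      case (Suc t)
      show ?case
      proof
        fix i assume i: "i \<in> {1..N + 1}"
        show "[\<eta> \<omega> (Suc t) i = \<theta> \<omega> (Suc t) (vtx N i)] (rmod (2 * pi))"
          unfolding \<eta>_step[OF Suc.IH i] \<theta>_Suc d_def
          by (rule lift_step(1)[OF assms(2) k ns inc bspec[OF Suc.IH] i])
      qed
    qed
    note \<eta>_step = \<eta>_step[OF cong]
    \<comment> \<open>Initially the total increment is 2 pi times the winding number, that is
      \<open>\<beta> * N\<close>; afterwards both ends of the lift change by the same
      amount.\<close>
    have period: "\<eta> \<omega> t (Suc N) = \<eta> \<omega> t 1 + \<beta> * N" for t
    proof (induction t)
      case 0
      have "\<eta> \<omega> 0 (Suc N) - \<eta> \<omega> 0 1 = (\<Sum>i=1..N. \<eta> \<omega> 0 (Suc i) - \<eta> \<omega> 0 i)"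
        using assms(2) by (subst sum_Suc_diff) auto
      also have "\<dots> = (\<Sum>i=1..N. delta N \<theta>0 i)"
        using inc[of _ 0] by (intro sum.cong) (auto simp: assms(5)[OF \<omega>])
      finally show ?case using assms(2) by (simp add: assms(6) winding_def)
    next
      case (Suc t)
      have "vtx N (Suc N) = vtx N 1" using assms(2) by (simp add: vtx_Suc vtx_id)
      then show ?case using Suc \<eta>_step[of "Suc N" t] \<eta>_step[of 1 t] by simp
    qed
    have step: "\<zeta> \<omega> (Suc t) i = gossip_step N (k t) (\<zeta> \<omega> t) i" if i: "i \<in> {1..N}" for t i
    proof -
      define u where "u = k t"
      define w where "w = vtx N (Suc u)"
      have u: "u \<in> {1..N}" and w: "w \<in> {1..N}" "w \<noteq> u" using k v by (auto simp: u_def w_def)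
      have \<zeta>: "\<zeta> \<omega> t' j = \<eta> \<omega> t' j - \<beta> * (real j - 1) - s \<omega> t' j" if "j \<in> {1..N}" for t' j
        using assms(10)[OF \<omega>] vtx_id[OF that] by (simp add: detrended_def)
      have \<eta>j: "\<eta> \<omega> (Suc t) j = \<eta> \<omega> t j + (if j = u then d t / 2 else 0) - (if j = w then d t / 2 else 0)"
        if "j \<in> {1..N}" for j
        using \<eta>_step[of j t] that vtx_id[OF that] by (simp add: u_def w_def)
      define m where "m = (s \<omega> t u + s \<omega> t w) / 2"
      have s: "s \<omega> (Suc t) = (s \<omega> t)(u := m + \<beta> / 2, w := m - \<beta> / 2)"
        by (simp add: assms(9)[OF \<omega>] Let_def m_def u_def w_def k_def)
      have "d t = \<eta> \<omega> t (Suc u) - \<eta> \<omega> t u" using inc[OF u, of t] by (simp add: d_def u_def)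
      \<comment> \<open>The factor \<open>real u + 1 - real w\<close> is 0 for an ordinary edge and
        \<open>N\<close> for the seam edge, where it encodes the jump of the lift.\<close>
      also have "\<eta> \<omega> t (Suc u) = \<eta> \<omega> t w + \<beta> * (real u + 1 - real w)"
        using u period[of t] assms(2) by (auto simp: w_def vtx_Suc)
      finally have d: "d t = \<eta> \<omega> t w + \<beta> * (real u + 1 - real w) - \<eta> \<omega> t u" .
      \<comment> \<open>At \<open>u\<close> and \<open>w\<close> the shifts by
        \<open>\<beta> / 2\<close> in the compensator cancel what averaging the lift leaves of the
        linear profile, the seam term included.\<close>
      consider "i = u" | "i = w" | "i \<noteq> u" "i \<noteq> w" by blast
      then show ?thesis
      proof cases
        case 1
        then show ?thesis
          using w u unfolding gossip_step_def u_def[symmetric] w_def[symmetric]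
          by (simp add: \<zeta> \<eta>j s d m_def) (simp add: algebra_simps add_divide_distrib diff_divide_distrib)
      next
        case 2
        then show ?thesis
          using w u unfolding gossip_step_def u_def[symmetric] w_def[symmetric]
          by (simp add: \<zeta> \<eta>j s d m_def) (simp add: algebra_simps add_divide_distrib diff_divide_distrib)
      next
        case 3
        then show ?thesis
          using i unfolding gossip_step_def u_def[symmetric] w_def[symmetric]
          by (simp add: \<zeta> \<eta>j s)
      qed
    qed
    show "\<exists>\<alpha>::real. (\<lambda>t. MAX i\<in>{1..N}. \<bar>\<zeta> \<omega> t i - \<alpha>\<bar>) \<longlonglongrightarrow> 0"
      by (rule gossip_consensus[where k = k and z = "\<zeta> \<omega>", OF assms(2) k step])
        (use elim(1) in \<open>auto simp: k_def\<close>)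
  qed
qed

end
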